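(* Let $B_2=\{312,321,1342\}$. A nonempty permutation belongs to $\operatorname{Av}(B_2)$ if and only if it is of the form $(\pi\ominus 1)\oplus\sigma$, where $\pi$ is an increasing permutation (possibly empty) and $\sigma$ is a Fibonacci permutation (possibly empty).
   Context: For a set $S$ of permutations, $\operatorname{Av}(S)$ is the set of all permutations avoiding every pattern in $S$ (classical pattern avoidance). A Fibonacci permutation is a permutation in $\operatorname{Av}(231,312,321)$. For permutations $\pi$ of length $n$ and $\sigma$ of length $k$, $\pi\oplus\sigma$ is $\pi$ followed by $\sigma$ with every entry of $\sigma$ increased by $n$; $\pi\ominus\sigma$ is $\pi$ followed by $\sigma$ with every entry of $\pi$ increased by $k$. Here $1$ denotes the permutation of length one. *)

theory Defs
  imports "HOL-Library.Sublist" "HOL-Combinatorics.Multiset_Permutations"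
begin

text \<open>A permutation of length \<open>n\<close> is its one-line notation, a list with entries \<open>1, \<dots>, n\<close>;
  the empty permutation is the empty list.\<close>

definition is_permutation :: "nat list \<Rightarrow> bool" where
  "is_permutation p \<longleftrightarrow> p \<in> permutations_of_set {1..length p}"

definition order_isomorphic :: "nat list \<Rightarrow> nat list \<Rightarrow> bool" where
  "order_isomorphic xs ys \<longleftrightarrow> length xs = length ys \<and>
     (\<forall>i < length xs. \<forall>j < length xs. xs ! i < xs ! j \<longleftrightarrow> ys ! i < ys ! j)"

text \<open>The entries realising a pattern need not be consecutive.\<close>

definition contains_pattern :: "nat list \<Rightarrow> nat list \<Rightarrow> bool" where
  "contains_pattern p s \<longleftrightarrow> (\<exists>xs. subseq xs p \<and> order_isomorphic xs s)"

definition Av :: "nat list set \<Rightarrow> nat list set" where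
  "Av S = {p. is_permutation p \<and> (\<forall>s\<in>S. \<not> contains_pattern p s)}"

definition fibonacci_permutation :: "nat list \<Rightarrow> bool" where
  "fibonacci_permutation p \<longleftrightarrow> p \<in> Av {[2,3,1], [3,1,2], [3,2,1]}"

definition increasing_permutation :: "nat list \<Rightarrow> bool" where
  "increasing_permutation p \<longleftrightarrow> is_permutation p \<and> sorted_wrt (<) p"

definition direct_sum :: "nat list \<Rightarrow> nat list \<Rightarrow> nat list" where
  "direct_sum p s = p @ map (\<lambda>x. x + length p) s"

definition skew_sum :: "nat list \<Rightarrow> nat list \<Rightarrow> nat list" where
  "skew_sum p s = map (\<lambda>x. x + length s) p @ s"

definition B2 :: "nat list set" where
  "B2 = {[3,1,2], [3,2,1], [1,3,4,2]}"

end

theory Submission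
  imports Defs
begin

text \<open>Cut a permutation at its entry 1. Avoiding 321 makes the prefix increasing, and avoiding 312
  puts every entry of the prefix below every entry of the suffix, so the permutation splits as a
  direct sum. Since the first summand is nonempty and lies below the second, 1342 is avoided exactly
  when the second summand avoids 231.\<close>

section \<open>Pattern containment as chains of inequalities between entries\<close>

lemma order_isomorphic_length: "order_isomorphic xs ys \<Longrightarrow> length xs = length ys"
  by (simp add: order_isomorphic_def)

lemma length_3_conv: "length xs = 3 \<longleftrightarrow> (\<exists>a b c. xs = [a,b,c])"
  by (auto simp: length_Suc_conv numeral_3_eq_3)

lemma length_4_conv: "length xs = 4 \<longleftrightarrow> (\<exists>a b c d. xs = [a,b,c,d])"
  by (auto simp: length_Suc_conv eval_nat_numeral)

text \<open>A chain of strict inequalities decides every pair of positions, so the quantified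
  comparison of indices collapses to that chain. The same reason serves the other three
  patterns.\<close>

lemma order_isomorphic_312:
  "order_isomorphic xs [3,1,2] \<longleftrightarrow> (\<exists>a b c. xs = [a,b,c] \<and> b < c \<and> c < a)"
proof -
  have "order_isomorphic [a,b,c] [3,1,2] \<longleftrightarrow> b < c \<and> c < a" for a b c
    by (simp add: order_isomorphic_def All_less_Suc2) linarith
  then show ?thesis
    using order_isomorphic_length[of xs "[3,1,2]"] length_3_conv[of xs] by auto
qed

lemma order_isomorphic_321:
  "order_isomorphic xs [3,2,1] \<longleftrightarrow> (\<exists>a b c. xs = [a,b,c] \<and> c < b \<and> b < a)"
proof -
  have "order_isomorphic [a,b,c] [3,2,1] \<longleftrightarrow> c < b \<and> b < a" for a b c
    by (simp add: order_isomorphic_def All_less_Suc2) linarith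
  then show ?thesis
    using order_isomorphic_length[of xs "[3,2,1]"] length_3_conv[of xs] by auto
qed

lemma order_isomorphic_231:
  "order_isomorphic xs [2,3,1] \<longleftrightarrow> (\<exists>a b c. xs = [a,b,c] \<and> c < a \<and> a < b)"
proof -
  have "order_isomorphic [a,b,c] [2,3,1] \<longleftrightarrow> c < a \<and> a < b" for a b c
    by (simp add: order_isomorphic_def All_less_Suc2) linarith
  then show ?thesis
    using order_isomorphic_length[of xs "[2,3,1]"] length_3_conv[of xs] by auto
qed

lemma order_isomorphic_1342:
  "order_isomorphic xs [1,3,4,2] \<longleftrightarrow> (\<exists>a b c d. xs = [a,b,c,d] \<and> a < d \<and> d < b \<and> b < c)"
proof -
  have "order_isomorphic [a,b,c,d] [1,3,4,2] \<longleftrightarrow> a < d \<and> d < b \<and> b < c" for a b c d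
    by (simp add: order_isomorphic_def All_less_Suc2) linarith
  then show ?thesis
    using order_isomorphic_length[of xs "[1,3,4,2]"] length_4_conv[of xs] by auto
qed

lemma contains_312:
  "contains_pattern p [3,1,2] \<longleftrightarrow> (\<exists>a b c. subseq [a,b,c] p \<and> b < c \<and> c < a)"
  unfolding contains_pattern_def order_isomorphic_312 by blast

lemma contains_321:
  "contains_pattern p [3,2,1] \<longleftrightarrow> (\<exists>a b c. subseq [a,b,c] p \<and> c < b \<and> b < a)"
  unfolding contains_pattern_def order_isomorphic_321 by blast

lemma contains_231:
  "contains_pattern p [2,3,1] \<longleftrightarrow> (\<exists>a b c. subseq [a,b,c] p \<and> c < a \<and> a < b)"
  unfolding contains_pattern_def order_isomorphic_231 by blast

lemma contains_1342:
  "contains_pattern p [1,3,4,2] \<longleftrightarrow> (\<exists>a b c d. subseq [a,b,c,d] p \<and> a < d \<and> d < b \<and> b < c)"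
  unfolding contains_pattern_def order_isomorphic_1342 by blast

section \<open>Subsequences of suffixes, shifts and short lists\<close>

lemma contains_pattern_append2:
  "contains_pattern q s \<Longrightarrow> contains_pattern (p @ q) s"
  unfolding contains_pattern_def using subseq_drop_many by blast

lemma order_isomorphic_map_shift:
  "order_isomorphic (map (\<lambda>x. x + m) xs) s \<longleftrightarrow> order_isomorphic xs s"
  by (auto simp: order_isomorphic_def)

lemma subseq_map_imp_map:
  "subseq xs (map f p) \<Longrightarrow> \<exists>ys. xs = map f ys \<and> subseq ys p"
  unfolding subseq_conv_nths by (auto simp: nths_map)

text \<open>A shift preserves order, and each subsequence of the shifted list is the shift of a
  subsequence. This carries avoidance between a summand and its raised copy in a direct sum.\<close>

lemma contains_pattern_map_shift:
  "contains_pattern (map (\<lambda>x. x + m) p) s \<longleftrightarrow> contains_pattern p s"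
  unfolding contains_pattern_def
  by (metis order_isomorphic_map_shift subseq_map subseq_map_imp_map)

lemma set_mono_subseq: "subseq xs ys \<Longrightarrow> set xs \<subseteq> set ys"
  by (auto elim: list_emb_set)

lemma sorted_wrt_iff_subseq:
  "sorted_wrt P xs \<longleftrightarrow> (\<forall>a b. subseq [a,b] xs \<longrightarrow> P a b)"
proof (induction xs)
  case (Cons x xs)
  \<comment> \<open>For \<open>a = x\<close>, simplification reduces
    \<open>subseq [a,b] (x # xs)\<close> to \<open>b \<in> set xs\<close>; this fact makes that
    weaker condition available when the pair lies inside \<open>xs\<close>.\<close>
  have "b \<in> set xs" if "subseq [a,b] xs" for a b
    using set_mono_subseq[OF that] by simp
  with Cons show ?case
    by (auto simp: subseq_singleton_left)
qed simp

lemma subseq_snocE: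
  assumes "subseq zs (xs @ [y])"
  obtains "subseq zs xs" | ws where "zs = ws @ [y]" "subseq ws xs"
proof -
  obtain us vs where "zs = us @ vs" "subseq us xs" "subseq vs [y]"
    using assms by (rule subseq_appendE)
  then show thesis using that
    by (cases vs) (auto simp: split: if_splits)
qed

section \<open>Recovering the summands from the sets of values\<close>

lemma is_permutation_iff:
  "is_permutation p \<longleftrightarrow> set p = {1..length p} \<and> distinct p"
  by (auto simp: is_permutation_def permutations_of_set_def)

text \<open>An element below \<open>Max A\<close> cannot lie in \<open>B\<close>, since it would
  then exceed \<open>Max A\<close>; hence \<open>A\<close> has no gaps.\<close>

lemma initial_segment_of_interval:
  assumes "A \<union> B = {1..n::nat}" "\<And>a b. a \<in> A \<Longrightarrow> b \<in> B \<Longrightarrow> a < b"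
  shows "A = {1..card A}"
proof (cases "A = {}")
  case False
  have fin: "finite A" using assms(1) by (metis finite_Un finite_atLeastAtMost)
  have "A = {1..Max A}"
  proof
    show "A \<subseteq> {1..Max A}" using assms(1) fin by auto
    show "{1..Max A} \<subseteq> A"
    proof
      fix x assume x: "x \<in> {1..Max A}"
      have M: "Max A \<in> A" using fin False by simp
      then have "Max A \<le> n" using assms(1) by auto
      with x have "x \<in> A \<union> B" using assms(1) by auto
      then show "x \<in> A" using assms(2)[OF M, of x] x by auto
    qed
  qed
  then show ?thesis by (metis card_atLeastAtMost diff_Suc_1)
qed simp

text \<open>The values of \<open>p\<close> form an initial segment, so those of \<open>q\<close>
  fill the rest of the interval, and lowering them by \<open>length p\<close> yields the second
  summand.\<close>

lemma direct_sum_of_below: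
  assumes "is_permutation (p @ q)" "\<And>a b. a \<in> set p \<Longrightarrow> b \<in> set q \<Longrightarrow> a < b"
  obtains \<sigma> where "is_permutation p" "is_permutation \<sigma>" "p @ q = direct_sum p \<sigma>"
proof
  have all: "set p \<union> set q = {1..length p + length q}"
    and d: "distinct p" "distinct q" "set p \<inter> set q = {}"
    using assms(1) by (auto simp: is_permutation_iff)
  have p: "set p = {1..length p}"
    using initial_segment_of_interval[OF all assms(2)] d distinct_card by metis
  then show "is_permutation p" using d by (simp add: is_permutation_iff)
  let ?f = "\<lambda>x. x - length p"
  have q: "set q = {length p + 1..length p + length q}"
  proof -
    have "set q = (set p \<union> set q) - set p" using d(3) by blast
    also have "\<dots> = {1..length p + length q} - {1..length p}" using all p by argo
    also have "\<dots> = {length p + 1..length p + length q}" by (auto simp: set_eq_iff)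
    finally show ?thesis .
  qed
  \<comment> \<open>Subtraction is truncated; it is injective here because all entries of
    \<open>q\<close> exceed \<open>length p\<close>.\<close>
  have inj: "inj_on ?f (set q)" unfolding q by (auto intro!: inj_onI)
  have "?f ` set q = {1..length q}"
  proof (intro equalityI subsetI)
    fix x assume "x \<in> {1..length q}"
    then have "x = ?f (x + length p)" "x + length p \<in> set q" unfolding q by auto
    then show "x \<in> ?f ` set q" by (rule image_eqI)
  qed (auto simp: q)
  then show "is_permutation (map ?f q)"
    using inj d by (simp add: is_permutation_iff distinct_map)
  have "map (\<lambda>x. x - length p + length p) q = q"
    by (rule map_idI) (auto simp: q)
  then show "p @ q = direct_sum p (map ?f q)"
    by (simp add: direct_sum_def o_def)
qed

text \<open>With the value 1 in last place, the other entries run through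
  \<open>{2..length xs + 1}\<close>, and lowering them by one keeps their order.\<close>

lemma skew_sum_one_of_increasing:
  assumes "is_permutation (xs @ [1])" "sorted_wrt (<) xs"
  obtains \<pi> where "increasing_permutation \<pi>" "xs @ [1] = skew_sum \<pi> [1]"
proof
  let ?f = "\<lambda>x::nat. x - 1"
  have "set xs \<union> {1} = {1..length xs + 1}" "1 \<notin> set xs" and d: "distinct xs"
    using assms(1) by (auto simp: is_permutation_iff)
  then have "set xs = {1..length xs + 1} - {1}" by blast
  also have "{1..length xs + 1} - {1} = {2..length xs + 1}" by (auto simp: set_eq_iff)
  finally have s: "set xs = {2..length xs + 1}" .
  have inj: "inj_on ?f (set xs)" unfolding s by (auto intro!: inj_onI)
  have "?f ` set xs = {1..length xs}"
  proof (intro equalityI subsetI)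
    fix x assume "x \<in> {1..length xs}"
    then have "x = ?f (x + 1)" "x + 1 \<in> set xs" unfolding s by auto
    then show "x \<in> ?f ` set xs" by (rule image_eqI)
  qed (auto simp: s)
  moreover have "sorted_wrt (<) (map ?f xs)"
    unfolding sorted_wrt_map
    by (rule sorted_wrt_mono_rel[OF _ assms(2)]) (auto simp: s)
  ultimately show "increasing_permutation (map ?f xs)"
    using inj d by (simp add: increasing_permutation_def is_permutation_iff distinct_map)
  have "map (\<lambda>x. x - 1 + 1) xs = xs"
    by (rule map_idI) (auto simp: s)
  then show "xs @ [1] = skew_sum (map ?f xs) [1]"
    by (simp add: skew_sum_def o_def)
qed

section \<open>The two directions of the characterization\<close>

lemma Av_B2_decompose:
  assumes "\<tau> \<in> Av B2" "\<tau> \<noteq> []"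
  shows "\<exists>\<pi> \<sigma>. increasing_permutation \<pi> \<and> fibonacci_permutation \<sigma> \<and>
    \<tau> = direct_sum (skew_sum \<pi> [1]) \<sigma>"
proof -
  have perm: "is_permutation \<tau>"
    and n312: "\<not> contains_pattern \<tau> [3,1,2]"
    and n321: "\<not> contains_pattern \<tau> [3,2,1]"
    and n1342: "\<not> contains_pattern \<tau> [1,3,4,2]"
    using assms(1) by (auto simp: Av_def B2_def)
  have "1 \<in> set \<tau>" using perm assms(2) by (cases \<tau>) (auto simp: is_permutation_iff)
  then obtain xs ys where \<tau>: "\<tau> = xs @ 1 # ys" by (meson split_list)
  have gt: "1 < x" if "x \<in> set xs \<union> set ys" for x
  proof -
    have "x \<in> {1..length \<tau>}" "x \<noteq> 1" using perm that by (auto simp: is_permutation_iff \<tau>)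
    then show ?thesis by auto
  qed
  have neq: "x \<noteq> y" if "subseq [x,y] \<tau>" for x y
    using perm that distinct_nthsI unfolding is_permutation_iff subseq_conv_nths
    by (metis distinct_length_2_or_more)
  have sorted: "sorted_wrt (<) xs"
    unfolding sorted_wrt_iff_subseq
  proof (intro allI impI)
    fix a b assume ab: "subseq [a,b] xs"
    \<comment> \<open>A descent in the prefix would be completed to 321 by the entry 1.\<close>
    then have "subseq ([a,b] @ [1]) (xs @ 1 # ys)" by (intro list_emb_append_mono) auto
    moreover have "b \<in> set xs" using set_mono_subseq[OF ab] by simp
    moreover have "a \<noteq> b" using neq ab \<tau> by (metis subseq_rev_drop_many)
    ultimately show "a < b" using n321 gt unfolding contains_321 \<tau> by fastforce
  qed
  have below: "a < b" if "a \<in> set (xs @ [1])" "b \<in> set ys" for a b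
  proof (cases "a = 1")
    case True
    then show ?thesis using gt that by auto
  next
    case False
    then have "subseq [a] xs" "subseq [b] ys" using that by (auto simp: subseq_singleton_left)
    \<comment> \<open>If \<open>b < a\<close>, these three entries would form a 312.\<close>
    then have "subseq ([a] @ 1 # [b]) \<tau>" unfolding \<tau>
      by (intro list_emb_append_mono) auto
    moreover have "a \<noteq> b" using perm False that by (auto simp: is_permutation_iff \<tau>)
    ultimately show ?thesis using n312 gt that unfolding contains_312
      by (metis Un_iff append_Cons append_Nil linorder_neqE_nat)
  qed
  obtain \<sigma> where \<sigma>: "is_permutation (xs @ [1])" "is_permutation \<sigma>"
      "(xs @ [1]) @ ys = direct_sum (xs @ [1]) \<sigma>"
    using direct_sum_of_below[of "xs @ [1]" ys] below perm \<tau> by auto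
  obtain \<pi> where \<pi>: "increasing_permutation \<pi>" "xs @ [1] = skew_sum \<pi> [1]"
    using skew_sum_one_of_increasing[OF \<sigma>(1) sorted] .
  have ys: "ys = map (\<lambda>x. x + length (xs @ [1])) \<sigma>"
    using \<sigma>(3) unfolding direct_sum_def by (metis same_append_eq)
  have \<tau>': "\<tau> = (xs @ [1]) @ ys" by (simp add: \<tau>)
  have "\<not> contains_pattern ys [3,1,2]" "\<not> contains_pattern ys [3,2,1]"
    using n312 n321 \<tau>' contains_pattern_append2 by metis+
  moreover have "\<not> contains_pattern ys [2,3,1]"
  proof
    assume "contains_pattern ys [2,3,1]"
    then obtain a b c where abc: "subseq [a,b,c] ys" "c < a" "a < b"
      unfolding contains_231 by blast
    then have "1 < c" using set_mono_subseq gt by fastforce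
    \<comment> \<open>Putting the entry 1 in front turns a 231 in \<open>ys\<close> into a
      1342.\<close>
    moreover have "subseq ([] @ 1 # [a,b,c]) \<tau>"
      unfolding \<tau> using abc by (intro list_emb_append_mono) auto
    ultimately show False using n1342 abc unfolding contains_1342 append_Nil by blast
  qed
  ultimately have "fibonacci_permutation \<sigma>"
    using \<sigma>(2) unfolding ys contains_pattern_map_shift
    by (auto simp: fibonacci_permutation_def Av_def)
  then show ?thesis using \<pi> \<sigma>(3) \<tau>' by metis
qed

text \<open>An occurrence of a pattern is cut at the boundary of the sum into a lower and an upper
  part. Each pattern of \<open>B2\<close> must then lie in a single summand, or leave a 231 in the
  second one.\<close>

lemma Av_B2_of_decomposition:
  assumes "is_permutation \<tau>" "increasing_permutation \<pi>" "fibonacci_permutation \<sigma>"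
    and \<tau>: "\<tau> = direct_sum (skew_sum \<pi> [1]) \<sigma>"
  shows "\<tau> \<in> Av B2"
proof -
  define xs where "xs = map Suc \<pi>"
  define ys where "ys = map (\<lambda>x. x + (length \<pi> + 1)) \<sigma>"
  have \<tau>': "\<tau> = (xs @ [1]) @ ys"
    by (simp add: \<tau> xs_def ys_def direct_sum_def skew_sum_def)
  have \<pi>: "set \<pi> = {1..length \<pi>}" "sorted_wrt (<) \<pi>"
    using assms(2) by (auto simp: increasing_permutation_def is_permutation_iff)
  have "set \<sigma> = {1..length \<sigma>}"
    using assms(3) by (simp add: fibonacci_permutation_def Av_def is_permutation_iff)
  then have below: "a < b" if "a \<in> set (xs @ [1])" "b \<in> set ys" for a b
    using that \<pi>(1) by (auto simp: xs_def ys_def)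
  have sorted: "a < b" if "subseq [a,b] xs" for a b
    using \<pi>(2) that sorted_wrt_iff_subseq[of "(<)" xs] by (simp add: xs_def sorted_wrt_map)
  have gt: "1 < x" if "x \<in> set xs" for x
    using that \<pi>(1) by (auto simp: xs_def)
  have avoid: "\<not> contains_pattern ys [2,3,1]" "\<not> contains_pattern ys [3,1,2]"
      "\<not> contains_pattern ys [3,2,1]"
    using assms(3) unfolding ys_def contains_pattern_map_shift
    by (auto simp: fibonacci_permutation_def Av_def)
  have split: "\<exists>us vs. zs = us @ vs \<and> subseq us (xs @ [1]) \<and> subseq vs ys \<and>
      (\<forall>u\<in>set us. \<forall>v\<in>set vs. u < v)" if sub: "subseq zs \<tau>" for zs
  proof -
    obtain us vs where "zs = us @ vs" "subseq us (xs @ [1])" "subseq vs ys"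
      using sub unfolding \<tau>' by (rule subseq_appendE)
    moreover have "\<forall>u\<in>set us. \<forall>v\<in>set vs. u < v"
      using calculation below set_mono_subseq by blast
    ultimately show ?thesis by blast
  qed
  \<comment> \<open>Every descent of \<open>xs @ [1]\<close> ends at its last entry; here
    \<open>c\<close> still follows, so \<open>a\<close> and \<open>b\<close> both lie in
    \<open>xs\<close>.\<close>
  have no_descent: "a < b" if "subseq [a,b,c] (xs @ [1])" for a b c
    using that
  proof (cases rule: subseq_snocE)
    case 1
    have "subseq ([a,b] @ []) [a,b,c]" by simp
    with 1 show ?thesis using sorted subseq_order.trans by (metis append_Nil2)
  qed (auto intro: sorted)
  \<comment> \<open>Since \<open>a\<close> is the largest of the three, no later entry can lie in
    the upper summand unless \<open>a\<close> does; a triple inside the lower summand contradicts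
    \<open>no_descent\<close>.\<close>
  have n3: False if "subseq [a,b,c] \<tau>" "b < a" "c < a" "\<not> subseq [a,b,c] ys" for a b c
    using split[OF that(1)] that no_descent[of a b c] by (auto simp: Cons_eq_append_conv)
  have "\<not> contains_pattern \<tau> [3,1,2]"
    unfolding contains_312 using n3 avoid(2) unfolding contains_312
    by (meson order.strict_trans)
  moreover have "\<not> contains_pattern \<tau> [3,2,1]"
    unfolding contains_321 using n3 avoid(3) unfolding contains_321
    by (meson order.strict_trans)
  moreover have "\<not> contains_pattern \<tau> [1,3,4,2]"
  proof
    assume "contains_pattern \<tau> [1,3,4,2]"
    then obtain a b c d where s: "subseq [a,b,c,d] \<tau>" and o: "a < d" "d < b" "b < c"
      unfolding contains_1342 by blast
    have n: "\<not> subseq [b,c,d] ys" using avoid(1) o unfolding contains_231 by blast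
    then have "\<not> subseq [a,b,c,d] ys" by (meson subseq_Cons')
    \<comment> \<open>As \<open>d\<close> is smaller than \<open>b\<close> and \<open>c\<close>, the
      cut cannot separate it from them, and \<open>n\<close> keeps these three out of
      \<open>ys\<close>.\<close>
    then have "subseq [a,b,c,d] (xs @ [1])"
      using split[OF s] n o by (auto simp: Cons_eq_append_conv)
    then show False
    \<comment> \<open>Either \<open>c\<close>, \<open>d\<close> is a descent inside the increasing
      \<open>xs\<close>, or \<open>d\<close> is the final 1 and \<open>a\<close> would have to be
      smaller.\<close>
    proof (cases rule: subseq_snocE)
      case 1
      then have "subseq [c,d] xs" by (meson subseq_Cons')
      then show False using sorted o by fastforce
    next
      case (2 ws)
      then have "a \<in> set xs" "d = 1" by (auto simp: Cons_eq_append_conv dest: set_mono_subseq)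
      then show False using gt o by fastforce
    qed
  qed
  ultimately show ?thesis using assms(1) by (auto simp: Av_def B2_def)
qed

theorem theorem2p6:
  fixes \<tau> :: "nat list"
  assumes "is_permutation \<tau>" and "\<tau> \<noteq> []"
  shows "\<tau> \<in> Av B2 \<longleftrightarrow>
    (\<exists>\<pi> \<sigma>. increasing_permutation \<pi> \<and> fibonacci_permutation \<sigma> \<and>
      \<tau> = direct_sum (skew_sum \<pi> [1]) \<sigma>)"
  using Av_B2_decompose[OF _ assms(2)] Av_B2_of_decomposition[OF assms(1)] by blast

end
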